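(* Let $D\subset\mathbb R^d$ be an arbitrary (nonempty) bounded open set, and let $B$ be its Chebychev ball, that is, the smallest closed ball that contains $D$. Then $$K_{n,D}\ge e^{-1}\,\frac{|D|}{|B|}\,n^{\frac{d+1}{d}},\qquad n\ge1,$$ for all $n$ of the form $n=\binom{d+\ell}{\ell}$, $\ell\ge0$, where $K_{n,D}$ is associated to the space $V_n=\mathbb P_\ell$ of polynomials of total degree at most $\ell$.
   Context: $|\cdot|$ denotes Lebesgue measure of sets. $D$ is equipped with the uniform probability measure $\mu_D=|D|^{-1}\chi_D\,dx$ and $L^2(D)=L^2(D,\mu_D)$. $\mathbb P_\ell$ is the space of real polynomials in $d$ variables of total degree at most $\ell$, of dimension $n=\binom{d+\ell}{\ell}$; $V_n=\mathbb P_\ell$. Define $k_{n,D}(x)=\max_{v\in V_n\setminus\{0\}}\frac{|v(x)|^2}{\|v\|_{L^2(D)}^2}$ and $K_{n,D}=\sup_{x\in D}k_{n,D}(x)$. *)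

theory Defs
  imports "HOL-Analysis.Analysis"
begin

definition total_degree_space :: "nat \<Rightarrow> (real ^ 'd \<Rightarrow> real) set" where
  "total_degree_space l =
     {v. \<exists>c :: ('d \<Rightarrow> nat) \<Rightarrow> real.
           v = (\<lambda>x. \<Sum>\<alpha> | (\<Sum>i\<in>UNIV. \<alpha> i) \<le> l. c \<alpha> * (\<Prod>i\<in>UNIV. x $ i ^ \<alpha> i))}"

text \<open>The index set above is finite, so the sum does not collapse to 0 by convention.\<close>

lemma finite_multi_indices: "finite {\<alpha> :: 'd::finite \<Rightarrow> nat. (\<Sum>i\<in>UNIV. \<alpha> i) \<le> l}"
proof (rule finite_subset)
  show "{\<alpha> :: 'd \<Rightarrow> nat. (\<Sum>i\<in>UNIV. \<alpha> i) \<le> l} \<subseteq> (UNIV :: 'd set) \<rightarrow>\<^sub>E {..l}"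
  proof (clarsimp simp: PiE_UNIV_domain)
    fix \<alpha> :: "'d \<Rightarrow> nat" and j
    assume "sum \<alpha> UNIV \<le> l"
    moreover have "\<alpha> j \<le> sum \<alpha> UNIV" by (rule member_le_sum) auto
    ultimately show "\<alpha> j \<le> l" by linarith
  qed
  show "finite ((UNIV :: 'd set) \<rightarrow>\<^sub>E {..l})" by (intro finite_PiE) auto
qed

text \<open>The squared norm of \<open>L\<^sup>2(D)\<close> with respect to the normalised Lebesgue measure on \<open>D\<close>.\<close>

definition L2_norm_sq :: "(real ^ 'd) set \<Rightarrow> (real ^ 'd \<Rightarrow> real) \<Rightarrow> real" where
  "L2_norm_sq D v = (\<integral>x. \<bar>v x\<bar>\<^sup>2 \<partial>uniform_measure lebesgue D)"

text \<open>The maximum over \<open>V - {0}\<close> and the supremum over \<open>D\<close> are taken in \<^typ>\<open>ereal\<close>, so that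
  they have their intended value whether or not the family is bounded.  For a nonempty bounded open
  \<open>D\<close> and a finite-dimensional space \<open>V\<close> of polynomials, the denominator is positive and the first
  supremum is attained.\<close>

definition k_fun :: "(real ^ 'd \<Rightarrow> real) set \<Rightarrow> (real ^ 'd) set \<Rightarrow> real ^ 'd \<Rightarrow> ereal" where
  "k_fun V D x = (SUP v \<in> V - {\<lambda>_. 0}. ereal (\<bar>v x\<bar>\<^sup>2 / L2_norm_sq D v))"

definition K_const :: "(real ^ 'd \<Rightarrow> real) set \<Rightarrow> (real ^ 'd) set \<Rightarrow> ereal" where
  "K_const V D = (SUP x \<in> D. k_fun V D x)"

text \<open>Among the closed balls containing \<open>D\<close>, smallest means of least radius.\<close>

definition is_chebyshev_ball :: "'a::euclidean_space set \<Rightarrow> 'a set \<Rightarrow> bool" where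
  "is_chebyshev_ball D B \<longleftrightarrow>
     (\<exists>c r. B = cball c r \<and> D \<subseteq> B \<and> (\<forall>c' r'. D \<subseteq> cball c' r' \<longrightarrow> r \<le> r'))"

lemma chebyshev_ball_ex1:
  fixes D :: "'a::euclidean_space set"
  assumes "bounded D" "D \<noteq> {}"
  shows "\<exists>!B. is_chebyshev_ball D B"
proof -
  obtain p where p: "p \<in> D" using assms by blast
  obtain R where R: "D \<subseteq> cball p R"
    using assms(1) by (metis bounded_any_center mem_cball subsetI)
  define S where "S = {(c, r). D \<subseteq> cball c r \<and> r \<le> R}"
  have S: "S = (\<Inter>x\<in>D. {z. dist (fst z) x \<le> snd z}) \<inter> {z. snd z \<le> R}"
    by (auto simp: S_def subset_eq mem_cball)
  have "closed S"
    unfolding S by (intro closed_Int closed_INT ballI closed_Collect_le continuous_intros)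
  moreover have "S \<subseteq> cball p R \<times> {0..R}"
  proof (clarsimp simp: S_def)
    fix c r assume h: "D \<subseteq> cball c r" "r \<le> R"
    have "dist c p \<le> r" using h p by (auto simp: subset_eq)
    moreover have "0 \<le> dist c p" by simp
    ultimately show "dist p c \<le> R \<and> 0 \<le> r" using h by (simp only: dist_commute) linarith
  qed
  then have "bounded S" by (rule bounded_subset[rotated]) (intro bounded_Times bounded_cball bounded_closed_interval)
  ultimately have "compact S" by (simp add: compact_eq_bounded_closed)
  moreover have "(p, R) \<in> S" using R by (simp add: S_def)
  then have "S \<noteq> {}" by blast
  moreover have "continuous_on S snd" by (intro continuous_intros)
  ultimately obtain z where z: "z \<in> S" "\<forall>y\<in>S. snd z \<le> snd y"
    using continuous_attains_inf by blast
  obtain c r where cr: "z = (c, r)" by fastforce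
  have 1: "D \<subseteq> cball c r" "r \<le> R" using z cr by (auto simp: S_def)
  have 2: "r \<le> r'" if "D \<subseteq> cball c' r'" for c' r'
  proof (cases "r' \<le> R")
    case True
    then have "(c', r') \<in> S" using that by (simp add: S_def)
    then show ?thesis using z cr by force
  qed (use 1 in auto)
  have ex: "is_chebyshev_ball D (cball c r)"
    unfolding is_chebyshev_ball_def using 1 2 by blast
  have "B = cball c r" if "is_chebyshev_ball D B" for B
  proof -
    obtain a s where B: "B = cball a s" "D \<subseteq> cball a s"
      "\<And>c' r'. D \<subseteq> cball c' r' \<Longrightarrow> s \<le> r'"
      using \<open>is_chebyshev_ball D B\<close> unfolding is_chebyshev_ball_def by (elim exE conjE) auto
    have [simp]: "s = r" by (rule order_antisym[OF B(3)[OF 1(1)] 2[OF B(2)]])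
    define m where "m = midpoint a c"
    have "D \<subseteq> cball m (sqrt (r\<^sup>2 - (dist a c / 2)\<^sup>2))"
    proof
      fix x assume "x \<in> D"
      then have d: "norm (x - a) \<le> r" "norm (x - c) \<le> r"
        using B 1 by (auto simp: subset_eq dist_norm norm_minus_commute)
      have "(norm (x - m))\<^sup>2 + (dist a c / 2)\<^sup>2 = ((norm (x - a))\<^sup>2 + (norm (x - c))\<^sup>2) / 2"
        unfolding m_def midpoint_def dist_norm power_divide power2_norm_eq_inner
        by (simp add: inner_simps inner_commute algebra_simps) (simp add: field_simps)
      also have "\<dots> \<le> (r\<^sup>2 + r\<^sup>2) / 2"
        using d by (intro divide_right_mono add_mono power_mono) auto
      finally have "(norm (x - m))\<^sup>2 \<le> r\<^sup>2 - (dist a c / 2)\<^sup>2" by simp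
      then show "x \<in> cball m (sqrt (r\<^sup>2 - (dist a c / 2)\<^sup>2))"
        by (simp add: dist_norm norm_minus_commute real_le_rsqrt)
    qed
    then have "r \<le> sqrt (r\<^sup>2 - (dist a c / 2)\<^sup>2)" by (rule 2)
    moreover have "dist c p \<le> r" using 1 p by (auto simp: subset_eq)
    then have "0 \<le> r" by (meson zero_le_dist order_trans)
    ultimately have "sqrt (r\<^sup>2) \<le> sqrt (r\<^sup>2 - (dist a c / 2)\<^sup>2)" by simp
    then have "r\<^sup>2 \<le> r\<^sup>2 - (dist a c / 2)\<^sup>2" by (simp only: real_sqrt_le_iff)
    then have "a = c" by simp
    then show ?thesis using B by simp
  qed
  with ex show ?thesis by blast
qed

end

theory Submission
  imports Defs
begin

text \<open>
  Let \<open>d\<close> be the dimension, \<open>c\<close> and \<open>r\<close> the centre and radius of \<open>B\<close>.  Since \<open>B\<close> is the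
  \<^emph>\<open>smallest\<close> ball around \<open>D\<close>, the closure of \<open>D\<close> meets the bounding sphere in some point
  \<open>c + r e\<close> with \<open>e\<close> a unit vector (\<open>chebyshev_ball_contact_point\<close>).  By continuity a polynomial
  \<open>v\<close> may be tested at this point although it need not belong to \<open>D\<close>
  (\<open>K_const_ge_at_closure_point\<close>), and enlarging the domain of integration from \<open>D\<close> to \<open>B\<close>
  increases the mean square by at most the factor \<open>|B| / |D|\<close>.  So it suffices to find \<open>v \<in> \<P>\<^sub>l\<close> which equals \<open>1\<close>
  at the point \<open>c + r e\<close> of the sphere and whose square has a small mean over \<open>B\<close>.

  A function of the single variable \<open>s = (1 - (x - c) \<bullet> e / r) / 2 \<in> [0, 1]\<close> will do.  Under the
  uniform distribution on \<open>B\<close> the variable \<open>s\<close> has the symmetric Beta distribution with parameter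
  \<open>a = (d + 1) / 2\<close>, hence the moments \<open>(a)\<^sub>k / (2 a)\<^sub>k\<close>
  (\<open>has_bochner_integral_cball_moment\<close>): slice the ball orthogonally to a coordinate axis, and
  rotate the axis into the direction \<open>e\<close>.  The polynomial of degree \<open>l\<close> with value \<open>1\<close> at
  \<open>s = 0\<close> and minimal mean square is the Jacobi polynomial orthogonal to
  \<open>s, s\<^sup>2, \<dots>, s\<^sup>l\<close>.  Its coefficients are hypergeometric, so orthogonality amounts to the fact that the
  \<open>l\<close>-th finite difference of a polynomial of degree less than \<open>l\<close> is zero
  (\<open>jacobi_orthogonal\<close>), and its mean square, which by orthogonality equals its mean, is
  \<open>(d + 1) / (2 l + d + 1) / n\<close> (\<open>jacobi_square_mean\<close>).

  It remains to see \<open>n powr (1 / d) \<le> exp 1 * (2 l + d + 1) / (d + 1)\<close>.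
  As \<open>n = (l + 1) \<cdots> (l + d) / d!\<close>, this follows from the inequality between the arithmetic and the
  geometric mean, from \<open>d! \<ge> (d / exp 1) ^ d\<close>, and from \<open>d + 1 \<le> 2 d\<close> (\<open>binomial_powr_le\<close>,
  \<open>christoffel_lower_bound\<close>).
\<close>

section \<open>Alternating binomial sums\<close>

text \<open>Absorption \<open>k (N choose k) = N (N - 1 choose k - 1)\<close>: a factor \<open>k\<close> lowers the order of
  the finite difference by one.\<close>

lemma sum_alternating_binomial_mult_of_nat:
  fixes h :: "nat \<Rightarrow> 'a::comm_ring_1"
  shows "(\<Sum>k\<le>Suc n. (-1) ^ k * of_nat (Suc n choose k) * (of_nat k * h k)) =
    - of_nat (Suc n) * (\<Sum>k\<le>n. (-1) ^ k * of_nat (n choose k) * h (Suc k))"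
proof -
  have absorb: "of_nat (Suc n choose Suc k) * of_nat (Suc k) =
      (of_nat (Suc n) * of_nat (n choose k) :: 'a)" for k
    by (metis Suc_times_binomial_eq of_nat_mult)
  have "(\<Sum>k\<le>Suc n. (-1) ^ k * of_nat (Suc n choose k) * (of_nat k * h k)) =
      (\<Sum>k\<le>n. (-1) ^ Suc k * (of_nat (Suc n choose Suc k) * of_nat (Suc k)) * h (Suc k))"
    by (subst sum.atMost_Suc_shift) (simp add: mult.assoc del: binomial_Suc_Suc of_nat_Suc)
  also have "\<dots> = (\<Sum>k\<le>n. - of_nat (Suc n) * ((-1) ^ k * of_nat (n choose k) * h (Suc k)))"
    unfolding absorb by (intro sum.cong) (simp_all add: mult_ac del: of_nat_Suc)
  finally show ?thesis by (simp only: sum_distrib_left)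
qed

text \<open>The \<open>n\<close>-th finite difference annihilates polynomials of degree less than \<open>n\<close>.  The
  polynomials that occur below come factored, and a product of linear factors suits an induction
  that removes one factor \<open>k + b\<close> at a time: the part \<open>k\<close> is absorbed into the binomial
  coefficient, the part \<open>b\<close> is constant.\<close>

lemma sum_alternating_binomial_prod_list_eq_0:
  fixes bs :: "'a::comm_ring_1 list"
  assumes "length bs < n"
  shows "(\<Sum>k\<le>n. (-1) ^ k * of_nat (n choose k) * (\<Prod>b\<leftarrow>bs. of_nat k + b)) = 0"
  using assms
proof (induction "length bs" arbitrary: bs n)
  case 0
  then show ?case using choose_alternating_sum[of n, where 'a = 'a] by simp
next
  case (Suc m)
  then obtain b bs' n' where eq: "bs = b # bs'" "n = Suc n'" "m = length bs'"
    by (cases bs; cases n) auto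
  let ?p = "\<lambda>k. \<Prod>b\<leftarrow>bs'. of_nat k + b"
  have shift: "?p (Suc k) = (\<Prod>b\<leftarrow>map ((+) 1) bs'. of_nat k + b)" for k
    by (simp add: o_def add_ac)
  have "(\<Sum>k\<le>n. (-1) ^ k * of_nat (n choose k) * (\<Prod>b\<leftarrow>bs. of_nat k + b)) =
      (\<Sum>k\<le>n. (-1) ^ k * of_nat (n choose k) * (of_nat k * ?p k)) +
      b * (\<Sum>k\<le>n. (-1) ^ k * of_nat (n choose k) * ?p k)"
    by (simp add: eq sum.distrib [symmetric] sum_distrib_left algebra_simps)
  also have "(\<Sum>k\<le>n. (-1) ^ k * of_nat (n choose k) * ?p k) = 0"
    using Suc eq by (intro Suc.hyps) auto
  also have "(\<Sum>k\<le>n. (-1) ^ k * of_nat (n choose k) * (of_nat k * ?p k)) = 0"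
    unfolding eq(2) sum_alternating_binomial_mult_of_nat shift
    using Suc eq by (subst Suc.hyps) auto
  finally show ?case by simp
qed

text \<open>The partial fraction expansion of \<open>n! / (a (a + 1) \<cdots> (a + n))\<close>, read from right to left.
  Pascal's rule gives the induction, since the sum for \<open>n + 1\<close> and \<open>a\<close> is the difference of the
  sums for \<open>n\<close> at \<open>a\<close> and at \<open>a + 1\<close>.\<close>

lemma sum_alternating_binomial_inverse_shift:
  fixes a :: real
  assumes "a > 0"
  shows "(\<Sum>k\<le>n. (-1) ^ k * of_nat (n choose k) / (of_nat k + a)) = fact n / pochhammer a (Suc n)"
  using assms
proof (induction n arbitrary: a)
  case (Suc n)
  define T where "T n a = (\<Sum>k\<le>n. (-1) ^ k * of_nat (n choose k) / (of_nat k + a))" for n and a :: real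
  have "T (Suc n) a = 1 / a + (\<Sum>k\<le>n. (-1) ^ Suc k * of_nat (Suc n choose Suc k) / (of_nat (Suc k) + a))"
    unfolding T_def by (subst sum.atMost_Suc_shift) simp
  also have "\<dots> = (1 / a + (\<Sum>k\<le>n. (-1) ^ Suc k * of_nat (n choose Suc k) / (of_nat (Suc k) + a))) - T n (a + 1)"
    unfolding T_def by (simp add: sum.distrib [symmetric] sum_negf [symmetric] sum_subtractf [symmetric]
        add_divide_distrib [symmetric] algebra_simps flip: diff_divide_distrib)
  also have "1 / a + (\<Sum>k\<le>n. (-1) ^ Suc k * of_nat (n choose Suc k) / (of_nat (Suc k) + a)) =
      (\<Sum>k\<le>Suc n. (-1) ^ k * of_nat (n choose k) / (of_nat k + a))"
    by (subst sum.atMost_Suc_shift) simp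
  also have "\<dots> = T n a" unfolding T_def by simp
  also have "T n a - T n (a + 1) = fact n / pochhammer a (Suc n) - fact n / pochhammer (a + 1) (Suc n)"
    using Suc.IH[of a] Suc.IH[of "a + 1"] Suc.prems by (simp add: T_def)
  also have "\<dots> = fact (Suc n) / pochhammer a (Suc (Suc n))"
  proof -
    have pos: "pochhammer (a + 1) n > 0" using Suc.prems by (intro pochhammer_pos) simp
    have 1: "pochhammer a (Suc n) = a * pochhammer (a + 1) n" by (rule pochhammer_rec)
    have 2: "pochhammer (a + 1) (Suc n) = pochhammer (a + 1) n * (a + 1 + n)" by (rule pochhammer_Suc)
    have 3: "pochhammer a (Suc (Suc n)) = a * (pochhammer (a + 1) n * (a + 1 + n))"
      using 2 by (simp only: pochhammer_rec)
    have "F / (a * P) - F / (P * c) = (c - a) * F / (a * (P * c))" if "P > 0" "c > 0" for F P c :: real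
      using that Suc.prems by (simp add: field_simps)
    from this[OF pos, of "a + 1 + n" "fact n"] show ?thesis
      unfolding 1 2 3 using Suc.prems by (simp add: add_ac)
  qed
  finally show ?case unfolding T_def .
qed simp

text \<open>A polynomial divided by \<open>k + a\<close> is its value at \<open>-a\<close> over \<open>k + a\<close>, plus a polynomial of lower
  degree; the finite difference annihilates the latter.\<close>

lemma sum_alternating_binomial_prod_list_divide:
  fixes a :: real
  assumes "a > 0" "length bs \<le> n"
  shows "(\<Sum>k\<le>n. (-1) ^ k * of_nat (n choose k) * ((\<Prod>b\<leftarrow>bs. of_nat k + b) / (of_nat k + a))) =
    (\<Prod>b\<leftarrow>bs. b - a) * (fact n / pochhammer a (Suc n))"
  using assms(2)
proof (induction bs)
  case Nil
  then show ?case using sum_alternating_binomial_inverse_shift[OF assms(1), of n] by simp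
next
  case (Cons b bs)
  let ?p = "\<lambda>k. \<Prod>b\<leftarrow>bs. of_nat k + b"
  have "(of_nat k + b) * ?p k / (of_nat k + a) = ?p k + (b - a) * (?p k / (of_nat k + a))" for k
  proof -
    have "of_nat k + a > 0" using assms(1) by (intro add_nonneg_pos) simp_all
    then show ?thesis by (simp add: field_simps)
  qed
  then have "(\<Sum>k\<le>n. (-1) ^ k * of_nat (n choose k) * ((\<Prod>b\<leftarrow>b # bs. of_nat k + b) / (of_nat k + a))) =
     (\<Sum>k\<le>n. (-1) ^ k * of_nat (n choose k) * ?p k) +
     (b - a) * (\<Sum>k\<le>n. (-1) ^ k * of_nat (n choose k) * (?p k / (of_nat k + a)))"
    by (simp add: sum_distrib_left sum.distrib [symmetric] algebra_simps)
  also have "(\<Sum>k\<le>n. (-1) ^ k * of_nat (n choose k) * ?p k) = 0"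
    using Cons.prems by (intro sum_alternating_binomial_prod_list_eq_0) simp
  also have "(\<Sum>k\<le>n. (-1) ^ k * of_nat (n choose k) * (?p k / (of_nat k + a))) =
    (\<Prod>b\<leftarrow>bs. b - a) * (fact n / pochhammer a (Suc n))"
    using Cons by simp
  finally show ?case by simp
qed

lemma prod_list_upt_eq_pochhammer:
  "(\<Prod>j\<leftarrow>[0..<n]. x + of_nat j) = pochhammer (x :: 'a::comm_semiring_1) n"
  by (induction n) (simp_all add: pochhammer_Suc mult_ac)

section \<open>A Jacobi polynomial of minimal mean square\<close>

text \<open>The \<open>k\<close>-th moment of the Beta distribution on \<open>[0, 1]\<close> with density proportional to
  \<open>(s (1 - s)) powr (a - 1)\<close>.\<close>

definition beta_moment :: "real \<Rightarrow> nat \<Rightarrow> real" where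
  "beta_moment a k = pochhammer a k / pochhammer (2 * a) k"

text \<open>The coefficient of \<open>s ^ k\<close> in the hypergeometric polynomial \<open>F(-l, l + 2 a; a + 1; s)\<close>, that is,
  of the Jacobi polynomial for the weight \<open>s powr a * (1 - s) powr (a - 1)\<close>, normalised to the value
  \<open>1\<close> at \<open>s = 0\<close>.\<close>

definition jacobi_coeff :: "real \<Rightarrow> nat \<Rightarrow> nat \<Rightarrow> real" where
  "jacobi_coeff a l k =
     (-1) ^ k * of_nat (l choose k) * pochhammer (2 * a + of_nat l) k / pochhammer (a + 1) k"

text \<open>Orthogonality to \<open>s ^ Suc i\<close>.  After cancelling Pochhammer symbols the summand is
  \<open>(-1) ^ k * (l choose k)\<close> times a polynomial in \<open>k\<close> of degree \<open>i + (l - 1 - i) < l\<close>.\<close>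

lemma jacobi_orthogonal:
  assumes a: "a > 0" and i: "i < l"
  shows "(\<Sum>k\<le>l. jacobi_coeff a l k * beta_moment a (k + Suc i)) = 0"
proof -
  define bs where "bs = map (\<lambda>j. a + 1 + of_nat j) [0..<i] @
     map (\<lambda>j. 2 * a + of_nat i + 1 + of_nat j) [0..<l - Suc i]"
  have "jacobi_coeff a l k * beta_moment a (k + Suc i) =
      a / pochhammer (2 * a) l * ((-1) ^ k * of_nat (l choose k) * (\<Prod>b\<leftarrow>bs. of_nat k + b))" for k
  proof -
    have 1: "pochhammer a (k + Suc i) = a * (pochhammer (a + 1) k * pochhammer (a + 1 + of_nat k) i)"
      by (simp only: add_Suc_right pochhammer_rec pochhammer_product')
    \<comment> \<open>Both sides are \<open>pochhammer (2 * a) (k + l)\<close>, split at different places.\<close>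
    have 2: "pochhammer (2 * a) (k + Suc i) * pochhammer (2 * a + of_nat (k + Suc i)) (l - Suc i) =
        pochhammer (2 * a) l * pochhammer (2 * a + of_nat l) k"
      using i by (simp only: pochhammer_product' [symmetric]) (simp add: algebra_simps)
    have 3: "(\<Prod>b\<leftarrow>bs. of_nat k + b) =
        pochhammer (a + 1 + of_nat k) i * pochhammer (2 * a + of_nat (k + Suc i)) (l - Suc i)"
      using prod_list_upt_eq_pochhammer[of "a + 1 + of_nat k" i]
        prod_list_upt_eq_pochhammer[of "2 * a + of_nat (k + Suc i)" "l - Suc i"]
      by (simp add: bs_def o_def add_ac)
    have pos: "pochhammer (2 * a) (k + Suc i) > 0" "pochhammer (2 * a) l > 0" "pochhammer (a + 1) k > 0"
      using a by (auto intro!: pochhammer_pos)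
    have "pochhammer (2 * a + of_nat l) k / pochhammer (2 * a) (k + Suc i) =
        pochhammer (2 * a + of_nat (k + Suc i)) (l - Suc i) / pochhammer (2 * a) l"
      using 2 pos by (simp add: field_simps)
    then have 4: "pochhammer (2 * a + of_nat l) k = pochhammer (2 * a + of_nat (k + Suc i)) (l - Suc i) *
        pochhammer (2 * a) (k + Suc i) / pochhammer (2 * a) l"
      using pos by (simp add: field_simps)
    show ?thesis unfolding jacobi_coeff_def beta_moment_def 1 3 4
      using pos by (simp del: add_Suc_right of_nat_add)
  qed
  then have "(\<Sum>k\<le>l. jacobi_coeff a l k * beta_moment a (k + Suc i)) =
      a / pochhammer (2 * a) l * (\<Sum>k\<le>l. (-1) ^ k * of_nat (l choose k) * (\<Prod>b\<leftarrow>bs. of_nat k + b))"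
    by (simp only: sum_distrib_left)
  also have "(\<Sum>k\<le>l. (-1) ^ k * of_nat (l choose k) * (\<Prod>b\<leftarrow>bs. of_nat k + b)) = 0"
    using i by (intro sum_alternating_binomial_prod_list_eq_0) (simp add: bs_def)
  finally show ?thesis by simp
qed

text \<open>Here the lowest moment leaves a denominator \<open>k + a\<close> under a polynomial in \<open>k\<close> of degree
  exactly \<open>l\<close>, so the sum is no longer zero.\<close>

lemma jacobi_mean:
  assumes a: "a > 0"
  shows "(\<Sum>k\<le>l. jacobi_coeff a l k * beta_moment a k) =
    a / (a + of_nat l) * (fact l / pochhammer (2 * a) l)"
proof -
  define bs where "bs = map (\<lambda>j. 2 * a + of_nat j) [0..<l]"
  have "jacobi_coeff a l k * beta_moment a k =
      a / pochhammer (2 * a) l * ((-1) ^ k * of_nat (l choose k) * ((\<Prod>b\<leftarrow>bs. of_nat k + b) / (of_nat k + a)))" for k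
  proof -
    have 1: "pochhammer a k * (of_nat k + a) = a * pochhammer (a + 1) k"
      using pochhammer_rec[of a k] pochhammer_Suc[of a k] by (simp add: algebra_simps)
    \<comment> \<open>Again both sides are \<open>pochhammer (2 * a) (k + l)\<close>.\<close>
    have 2: "pochhammer (2 * a) k * pochhammer (2 * a + of_nat k) l =
        pochhammer (2 * a) l * pochhammer (2 * a + of_nat l) k"
      by (metis add.commute pochhammer_product')
    have 3: "(\<Prod>b\<leftarrow>bs. of_nat k + b) = pochhammer (2 * a + of_nat k) l"
      using prod_list_upt_eq_pochhammer[of "2 * a + of_nat k" l] by (simp add: bs_def o_def add_ac)
    have pos: "pochhammer (2 * a) k > 0" "pochhammer (2 * a) l > 0" "pochhammer (a + 1) k > 0" "of_nat k + a > 0"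
      using a by (auto intro!: pochhammer_pos add_nonneg_pos)
    have 4: "pochhammer (2 * a + of_nat l) k = pochhammer (2 * a) k * pochhammer (2 * a + of_nat k) l / pochhammer (2 * a) l"
      using 2 pos by (simp add: field_simps)
    have 5: "pochhammer a k = a * pochhammer (a + 1) k / (of_nat k + a)"
      using 1 pos by (simp add: field_simps)
    show ?thesis unfolding jacobi_coeff_def beta_moment_def 3 4 5
      using pos by simp
  qed
  then have "(\<Sum>k\<le>l. jacobi_coeff a l k * beta_moment a k) =
      a / pochhammer (2 * a) l * (\<Sum>k\<le>l. (-1) ^ k * of_nat (l choose k) * ((\<Prod>b\<leftarrow>bs. of_nat k + b) / (of_nat k + a)))"
    by (simp only: sum_distrib_left)
  also have "\<dots> = a / pochhammer (2 * a) l * ((\<Prod>b\<leftarrow>bs. b - a) * (fact l / pochhammer a (Suc l)))"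
    using a by (subst sum_alternating_binomial_prod_list_divide) (simp_all add: bs_def)
  also have "(\<Prod>b\<leftarrow>bs. b - a) = pochhammer a l"
    using prod_list_upt_eq_pochhammer[of a l] by (simp add: bs_def o_def)
  also have "pochhammer a l * (fact l / pochhammer a (Suc l)) = fact l / (a + of_nat l)"
    using pochhammer_pos[OF a, of l] by (simp add: pochhammer_Suc)
  finally show ?thesis by simp
qed

text \<open>The double sum is the mean of the square of the Jacobi polynomial.  One factor may be replaced by its
  constant term \<open>1\<close>, because the other is orthogonal to \<open>s, \<dots>, s ^ l\<close>.\<close>

lemma jacobi_square_mean:
  assumes a: "a > 0"
  shows "(\<Sum>i\<le>l. \<Sum>k\<le>l. jacobi_coeff a l i * jacobi_coeff a l k * beta_moment a (k + i)) =
    a / (a + of_nat l) * (fact l / pochhammer (2 * a) l)"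
proof -
  have "(\<Sum>i\<le>l. \<Sum>k\<le>l. jacobi_coeff a l i * jacobi_coeff a l k * beta_moment a (k + i)) =
      (\<Sum>i\<le>l. jacobi_coeff a l i * (\<Sum>k\<le>l. jacobi_coeff a l k * beta_moment a (k + i)))"
    by (simp add: sum_distrib_left mult.assoc)
  also have "\<dots> = (\<Sum>i\<in>{0}. jacobi_coeff a l i * (\<Sum>k\<le>l. jacobi_coeff a l k * beta_moment a (k + i)))"
  proof (rule sum.mono_neutral_right)
    show "\<forall>i\<in>{..l} - {0}. jacobi_coeff a l i * (\<Sum>k\<le>l. jacobi_coeff a l k * beta_moment a (k + i)) = 0"
    proof
      fix i assume "i \<in> {..l} - {0}"
      then obtain j where "i = Suc j" "j < l" by (cases i) auto
      then show "jacobi_coeff a l i * (\<Sum>k\<le>l. jacobi_coeff a l k * beta_moment a (k + i)) = 0"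
        using jacobi_orthogonal[OF a] by simp
    qed
  qed auto
  also have "\<dots> = (\<Sum>k\<le>l. jacobi_coeff a l k * beta_moment a k)"
    by (simp add: jacobi_coeff_def)
  finally show ?thesis by (simp only: jacobi_mean[OF a])
qed

section \<open>Comparing the minimal mean square with the dimension\<close>

lemma power_divide_fact_le_exp: "(x :: real) ^ n / fact n \<le> exp x" if "x \<ge> 0"
proof -
  have s: "summable (\<lambda>k. x ^ k /\<^sub>R fact k)" by (rule summable_exp_generic)
  have "x ^ n / fact n = (\<Sum>k\<in>{n}. x ^ k /\<^sub>R fact k)" by (simp add: field_simps)
  also have "\<dots> \<le> (\<Sum>k. x ^ k /\<^sub>R fact k)"
    using s that by (intro sum_le_suminf) simp_all
  finally show ?thesis by (simp add: exp_def)
qed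

text \<open>The arithmetic-geometric mean inequality bounds \<open>(l + 1) \<cdots> (l + d)\<close> from above, and
  \<open>d! \<ge> (d / exp 1) ^ d\<close> bounds the denominator of the binomial coefficient from below.\<close>

lemma binomial_powr_le:
  assumes d: "d > 0"
  shows "real ((d + l) choose l) powr (1 / real d) \<le> exp 1 * ((2 * real l + real d + 1) / (2 * real d))"
proof -
  have n: "real ((d + l) choose l) = (\<Prod>i=1..d. real l + real i) / fact d"
  proof -
    have "real ((d + l) choose l) = pochhammer (real l + 1) d / fact d"
      using binomial_symmetric[of l "d + l"] binomial_gbinomial[of "d + l" d, where 'a = real]
      by (simp add: gbinomial_pochhammer' add_ac)
    also have "pochhammer (real l + 1) d = (\<Prod>i=1..d. real l + real i)"
      by (simp add: pochhammer_prod prod.atLeast1_atMost_eq add_ac atLeast0LessThan)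
    finally show ?thesis .
  qed
  have 1: "(\<Prod>i=1..d. real l + real i) powr (1 / real d) \<le> (2 * real l + real d + 1) / 2"
  proof -
    have "(\<Prod>i=1..d. real l + real i) powr (1 / real (card {1..d})) \<le>
        (\<Sum>i=1..d. (real l + real i) / real (card {1..d}))"
      by (intro arith_geom_mean) (use d in auto)
    also have "\<dots> = (\<Sum>i=1..d. real l + real i) / real d"
      by (simp add: sum_divide_distrib)
    also have "(\<Sum>i=1..d. real l + real i) = real d * (2 * real l + real d + 1) / 2"
      by (induction d) (simp_all add: field_simps)
    finally show ?thesis using d by simp
  qed
  have 2: "real d / exp 1 \<le> fact d powr (1 / real d)"
  proof -
    have "(real d / exp 1) ^ d \<le> fact d"
      using power_divide_fact_le_exp[of "real d" d]
      by (simp add: power_divide field_simps exp_of_nat_mult [symmetric])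
    then have "((real d / exp 1) ^ d) powr (1 / real d) \<le> fact d powr (1 / real d)"
      by (intro powr_mono2) simp_all
    moreover have "((real d / exp 1) ^ d) powr (1 / real d) = real d / exp 1"
      using d by (simp add: powr_realpow [symmetric] powr_powr)
    ultimately show ?thesis by simp
  qed
  have "real ((d + l) choose l) powr (1 / real d) =
      (\<Prod>i=1..d. real l + real i) powr (1 / real d) / fact d powr (1 / real d)"
    unfolding n by (rule powr_divide)
  also have "\<dots> \<le> ((2 * real l + real d + 1) / 2) / (real d / exp 1)"
    using 1 2 d by (intro frac_le) auto
  also have "\<dots> = exp 1 * ((2 * real l + real d + 1) / (2 * real d))" by simp
  finally show ?thesis .
qed

text \<open>With \<open>2 * a = d + 1\<close> the factor \<open>fact l / pochhammer (2 * a) l\<close> is \<open>1 / n\<close>, so the minimal mean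
  square is \<open>(d + 1) / (2 * l + d + 1) / n\<close>.\<close>

lemma christoffel_lower_bound:
  fixes d l :: nat
  assumes d: "d > 0"
  defines "n \<equiv> (d + l) choose l" and "a \<equiv> (real d + 1) / 2"
  shows "exp (-1) * real n powr ((real d + 1) / real d) * (a / (a + real l) * (fact l / pochhammer (2 * a) l)) \<le> 1"
proof -
  have npos: "real n > 0" unfolding n_def by simp
  have two_a: "2 * a = real d + 1" by (simp add: a_def)
  have n: "real n = pochhammer (2 * a) l / fact l"
    using binomial_gbinomial[of "d + l" l, where 'a = real]
    unfolding two_a by (simp add: n_def gbinomial_pochhammer' add_ac)
  have Q: "a / (a + real l) * (fact l / pochhammer (2 * a) l) = (real d + 1) / (2 * real l + real d + 1) / real n"
  proof -
    have "a / (a + real l) = (real d + 1) / (2 * real l + real d + 1)"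
      by (simp add: a_def field_simps)
    then show ?thesis unfolding n by simp
  qed
  have "real n powr ((real d + 1) / real d) = real n * real n powr (1 / real d)"
    using d npos by (simp add: add_divide_distrib powr_add)
  also have "\<dots> \<le> real n * (exp 1 * ((2 * real l + real d + 1) / (2 * real d)))"
    unfolding n_def by (intro mult_left_mono binomial_powr_le d) simp
  also have "\<dots> \<le> real n * (exp 1 * ((2 * real l + real d + 1) / (real d + 1)))"
    using d by (intro mult_left_mono divide_left_mono) simp_all
  finally have *: "real n powr ((real d + 1) / real d) \<le> real n * (exp 1 * ((2 * real l + real d + 1) / (real d + 1)))" .
  have "exp (-1) * real n powr ((real d + 1) / real d) * (a / (a + real l) * (fact l / pochhammer (2 * a) l))
     \<le> exp (-1) * (real n * (exp 1 * ((2 * real l + real d + 1) / (real d + 1)))) * ((real d + 1) / (2 * real l + real d + 1) / real n)"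
    unfolding Q by (intro mult_right_mono mult_left_mono *) simp_all
  also have "\<dots> = exp (-1) * exp 1"
  proof -
    have "u * (m * (v * (x / y))) * (y / x / m) = u * v" if "m > 0" "x > 0" "y > 0" for u v m x y :: real
      using that by (simp add: field_simps)
    then show ?thesis using npos by simp
  qed
  also have "\<dots> = 1" by (simp add: exp_minus)
  finally show ?thesis .
qed

section \<open>Rotation invariance of Lebesgue measure\<close>

lemma continuous_on_orthogonal_transformation:
  fixes f :: "'a::euclidean_space \<Rightarrow> 'a"
  assumes "orthogonal_transformation f"
  shows "continuous_on S f"
  using orthogonal_transformation_linear[OF assms]
  by (intro linear_continuous_on) (simp add: linear_conv_bounded_linear)

text \<open>By Vitali's covering theorem an open set is, up to a null set, a disjoint union of balls, and the
  preimage of a ball under an orthogonal transformation is a ball of the same radius.  Only one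
  inequality comes out of this, because the preimage of the null set is discarded; the same
  inequality for the inverse transformation supplies the other one.\<close>

lemma emeasure_lborel_le_orthogonal_vimage:
  fixes f :: "'a::euclidean_space \<Rightarrow> 'a"
  assumes f: "orthogonal_transformation f" and U: "open U"
  shows "emeasure lborel U \<le> emeasure lborel (f -` U)"
proof -
  \<comment> \<open>A ball is represented by its centre and its radius.\<close>
  define K where "K = {(x, r). 0 < r \<and> ball x r \<subseteq> U}"
  have "\<exists>i. i \<in> K \<and> x \<in> ball (fst i) (snd i) \<and> snd i < d" if x: "x \<in> U" and d: "0 < d" for x d
  proof -
    obtain e where e: "0 < e" "ball x e \<subseteq> U" using U x by (meson openE)
    have "(x, min (d / 2) e) \<in> K" using e d by (auto simp: K_def)
    then show ?thesis using e d by (intro exI[of _ "(x, min (d / 2) e)"]) auto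
  qed
  then obtain C where C: "countable C" "C \<subseteq> K"
      "pairwise (\<lambda>i j. disjnt (ball (fst i) (snd i)) (ball (fst j) (snd j))) C"
      "negligible (U - (\<Union>i\<in>C. ball (fst i) (snd i)))"
    using Vitali_covering_theorem_balls[of U K fst snd] by blast
  let ?B = "\<lambda>i. ball (fst i) (snd i)"
  have cont: "continuous_on UNIV f"
    by (rule continuous_on_orthogonal_transformation[OF f])
  have vim_open: "open (f -` S)" if "open S" for S
    using cont that by (simp add: open_vimage)
  have vim_ball: "emeasure lborel (f -` ball x r) = emeasure lborel (ball x r)" if "r > 0" for x r
  proof -
    obtain y where y: "f y = x" using orthogonal_transformation_surj[OF f] by (metis surjD)
    have "f -` ball x r = ball y r"
      using f y by (auto simp: orthogonal_transformation_isometry dist_commute)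
    then show ?thesis using that by (simp add: emeasure_ball)
  qed
  have disj: "disjoint_family_on ?B C" "disjoint_family_on (\<lambda>i. f -` ?B i) C"
    using C(3) unfolding disjoint_family_on_def pairwise_def disjnt_def
    by (blast, metis vimage_Int vimage_empty)
  have "emeasure lborel U \<le> emeasure lborel ((\<Union>i\<in>C. ?B i) \<union> (U - (\<Union>i\<in>C. ?B i)))"
    by (rule emeasure_mono) (use U in \<open>auto intro!: borel_open open_UN sets.Diff\<close>)
  also have "\<dots> = emeasure lborel (\<Union>i\<in>C. ?B i)"
  proof (rule emeasure_Un_null_set)
    have "open (\<Union>i\<in>C. ?B i)" by blast
    with U have "U - (\<Union>i\<in>C. ?B i) \<in> sets lborel"
      by (simp add: sets.Diff borel_open)
    then show "U - (\<Union>i\<in>C. ?B i) \<in> null_sets lborel"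
      using C(4) by (simp add: negligible_iff_null_sets null_sets_completion_iff)
  qed (auto intro!: borel_open open_UN)
  also have "\<dots> = (\<integral>\<^sup>+i. emeasure lborel (?B i) \<partial>count_space C)"
    using C disj by (intro emeasure_UN_countable) auto
  also have "\<dots> = (\<integral>\<^sup>+i. emeasure lborel (f -` ?B i) \<partial>count_space C)"
    using C(2) by (intro nn_integral_cong) (auto simp: vim_ball K_def)
  also have "\<dots> = emeasure lborel (\<Union>i\<in>C. f -` ?B i)"
    using C disj by (intro emeasure_UN_countable [symmetric]) (auto intro!: borel_open vim_open)
  also have "\<dots> \<le> emeasure lborel (f -` U)"
  proof (rule emeasure_mono)
    have "?B i \<subseteq> U" if "i \<in> C" for i
      using subsetD[OF C(2) that] by (simp add: K_def case_prod_unfold)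
    then show "(\<Union>i\<in>C. f -` ?B i) \<subseteq> f -` U" by blast
  qed (simp add: borel_open vim_open U)
  finally show ?thesis .
qed

lemma distr_lborel_orthogonal:
  fixes f :: "'a::euclidean_space \<Rightarrow> 'a"
  assumes f: "orthogonal_transformation f"
  shows "distr lborel borel f = lborel"
proof (rule lborel_eqI [symmetric])
  have [measurable]: "f \<in> borel_measurable borel"
    using continuous_on_orthogonal_transformation[OF f] by (rule borel_measurable_continuous_onI)
  have inv: "orthogonal_transformation (inv f)" by (rule orthogonal_transformation_inv[OF f])
  fix l u :: 'a assume lu: "\<And>b. b \<in> Basis \<Longrightarrow> l \<bullet> b \<le> u \<bullet> b"
  have "emeasure lborel (f -` box l u) \<le> emeasure lborel (inv f -` (f -` box l u))"
    using continuous_on_orthogonal_transformation[OF f] by (intro emeasure_lborel_le_orthogonal_vimage inv open_vimage open_box)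
  also have "inv f -` (f -` box l u) = box l u"
    using orthogonal_transformation_surj[OF f] by (auto simp: surj_f_inv_f)
  finally have "emeasure lborel (f -` box l u) = emeasure lborel (box l u)"
    using emeasure_lborel_le_orthogonal_vimage[OF f open_box, of l u] by (intro antisym)
  then show "emeasure (distr lborel borel f) (box l u) = (\<Prod>b\<in>Basis. (u - l) \<bullet> b)"
    using lu by (simp add: emeasure_distr emeasure_lborel_box_eq inner_diff_left)
qed simp

section \<open>Moments of a linear functional over a ball\<close>

text \<open>Fubini: the slice of the unit ball at height \<open>t\<close> along a coordinate axis is a ball of radius
  \<open>sqrt (1 - t\<^sup>2)\<close> in one dimension less.\<close>

lemma nn_integral_unit_cball_axis:
  fixes b :: "'a::euclidean_space" and g :: "real \<Rightarrow> ennreal"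
  assumes b: "b \<in> Basis" and g [measurable]: "g \<in> borel_measurable borel"
  shows "(\<integral>\<^sup>+x. g (x \<bullet> b) * indicator (cball 0 1) x \<partial>lborel) =
    (\<integral>\<^sup>+t. g t * ennreal (indicator {-1..1} t * (unit_ball_vol (real (DIM('a) - 1)) * sqrt (1 - t\<^sup>2) ^ (DIM('a) - 1))) \<partial>lborel)"
proof -
  define A where "A = (Basis :: 'a set) - {b}"
  have A: "finite A" "b \<notin> A" "insert b A = Basis" "card A = DIM('a) - 1"
    using b by (auto simp: A_def)
  let ?V = "unit_ball_vol (real (card A))"
  let ?L = "\<lambda>I. Pi\<^sub>M I (\<lambda>_::'a. lborel :: real measure)"
  interpret product_sigma_finite "\<lambda>_::'a. lborel :: real measure" by standard
  have [measurable]: "cball (0 :: 'a) 1 \<in> sets borel" by simp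
  have [measurable]: "(\<lambda>x::'a. g (x \<bullet> b) * indicator (cball 0 1) x) \<in> borel_measurable borel"
    by measurable
  have "(\<integral>\<^sup>+x. g (x \<bullet> b) * indicator (cball 0 1) x \<partial>lborel) =
      (\<integral>\<^sup>+f. g ((\<Sum>c\<in>Basis. f c *\<^sub>R c) \<bullet> b) * indicator (cball 0 1) (\<Sum>c\<in>Basis. f c *\<^sub>R c) \<partial>?L Basis)"
    by (subst lborel_eq, subst nn_integral_distr) auto
  also have "\<dots> = (\<integral>\<^sup>+f. g (f b) * indicator {..1} (sqrt ((f b)\<^sup>2 + (\<Sum>i\<in>A. (f i)\<^sup>2))) \<partial>?L (insert b A))"
  proof -
    have "norm (\<Sum>c\<in>Basis. f c *\<^sub>R c :: 'a) = sqrt ((f b)\<^sup>2 + (\<Sum>i\<in>A. (f i)\<^sup>2))" for f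
    proof -
      have "norm (\<Sum>c\<in>Basis. f c *\<^sub>R c :: 'a) = sqrt (\<Sum>c\<in>Basis. (f c)\<^sup>2)"
        using euclidean_dist_l2[of "0 :: 'a" "\<Sum>c\<in>Basis. f c *\<^sub>R c"] by (simp add: L2_set_def dist_norm)
      also have "(\<Sum>c\<in>Basis. (f c)\<^sup>2) = (f b)\<^sup>2 + (\<Sum>i\<in>A. (f i)\<^sup>2)"
        using A by (metis sum.insert)
      finally show ?thesis .
    qed
    then show ?thesis using b by (simp add: A(3) indicator_def)
  qed
  also have "\<dots> = (\<integral>\<^sup>+y. \<integral>\<^sup>+f. g y * indicator {..1} (sqrt (y\<^sup>2 + (\<Sum>i\<in>A. ((f(b := y)) i)\<^sup>2))) \<partial>?L A \<partial>lborel)"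
  proof (subst product_nn_integral_insert_rev)
    have [measurable]: "(\<lambda>f. f i) \<in> borel_measurable (?L (insert b A))" if "i \<in> insert b A" for i
      using measurable_component_singleton[OF that, of "\<lambda>_. lborel"] by simp
    show "(\<lambda>f. g (f b) * indicator {..1} (sqrt ((f b)\<^sup>2 + (\<Sum>i\<in>A. (f i)\<^sup>2)))) \<in> borel_measurable (?L (insert b A))"
      by measurable
  qed (use A in simp_all)
  also have "\<dots> = (\<integral>\<^sup>+y. \<integral>\<^sup>+f. g y * indicator {-1..1} y *
      indicator ({f. sqrt (\<Sum>i\<in>A. (f i)\<^sup>2) \<le> sqrt (1 - y\<^sup>2)} \<inter> space (?L A)) f \<partial>?L A \<partial>lborel)"
  proof (intro nn_integral_cong, goal_cases)
    case (1 y f)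
    have S: "(\<Sum>i\<in>A. (f i)\<^sup>2) \<ge> 0" by (intro sum_nonneg) simp
    have "y\<^sup>2 \<le> 1 \<longleftrightarrow> y \<in> {-1..1}" by (auto simp: abs_square_le_1 abs_le_iff)
    then have "sqrt (y\<^sup>2 + (\<Sum>i\<in>A. (f i)\<^sup>2)) \<le> 1 \<longleftrightarrow>
        y \<in> {-1..1} \<and> sqrt (\<Sum>i\<in>A. (f i)\<^sup>2) \<le> sqrt (1 - y\<^sup>2)"
      using S by auto
    moreover have "(\<Sum>i\<in>A. ((f(b := y)) i)\<^sup>2) = (\<Sum>i\<in>A. (f i)\<^sup>2)"
      using A by (intro sum.cong) auto
    ultimately show ?case using 1 by (simp add: indicator_def)
  qed
  also have "\<dots> = (\<integral>\<^sup>+y. g y * indicator {-1..1} y *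
      emeasure (?L A) ({f. sqrt (\<Sum>i\<in>A. (f i)\<^sup>2) \<le> sqrt (1 - y\<^sup>2)} \<inter> space (?L A)) \<partial>lborel)"
    using A(1) by (intro nn_integral_cong, subst nn_integral_cmult_indicator) auto
  also have "\<dots> = (\<integral>\<^sup>+y. g y * ennreal (indicator {-1..1} y * (?V * sqrt (1 - y\<^sup>2) ^ card A)) \<partial>lborel)"
  proof (intro nn_integral_cong_AE, goal_cases)
    case 1
    \<comment> \<open>The volume formula for the slices needs a positive radius, so the two end points are discarded.\<close>
    have "AE y in lborel. y \<notin> {-1, 1 :: real}"
      by (intro AE_not_in countable_imp_null_set_lborel) auto
    then show ?case
    proof eventually_elim
      case (elim y)
      show ?case
      proof (cases "y \<in> {-1<..<1}")
        case True
        then have "y\<^sup>2 < 1" by (simp add: abs_square_less_1 abs_less_iff)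
        then show ?thesis using A(1) True by (subst emeasure_cball_aux) auto
      qed (use elim in auto)
    qed
  qed
  finally show ?thesis by (simp only: A(4))
qed

lemma nn_integral_unit_cball_direction:
  fixes e :: "real ^ 'd" and g :: "real \<Rightarrow> ennreal"
  assumes e: "norm e = 1" and g [measurable]: "g \<in> borel_measurable borel"
  shows "(\<integral>\<^sup>+x. g (x \<bullet> e) * indicator (cball 0 1) x \<partial>lborel) =
    (\<integral>\<^sup>+t. g t * ennreal (indicator {-1..1} t * (unit_ball_vol (real (CARD('d) - 1)) * sqrt (1 - t\<^sup>2) ^ (CARD('d) - 1))) \<partial>lborel)"
proof -
  \<comment> \<open>Any coordinate axis serves as the reference direction.\<close>
  obtain i :: "'d" where True by simp
  define b where "b = axis i (1::real)"
  have b: "b \<in> Basis" "norm b = 1" by (simp_all add: b_def axis_in_Basis_iff)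
  obtain f where f: "orthogonal_transformation f" "f e = b"
    using orthogonal_transformation_exists_1[OF e b(2)] .
  have [measurable]: "f \<in> borel_measurable borel"
    by (intro borel_measurable_continuous_onI continuous_on_orthogonal_transformation f)
  have [measurable]: "cball (0 :: real ^ 'd) 1 \<in> sets borel" by simp
  have [measurable]: "(\<lambda>x. g (x \<bullet> b) * indicator (cball 0 1) x) \<in> borel_measurable borel"
    by measurable
  have "(\<integral>\<^sup>+x. g (x \<bullet> b) * indicator (cball 0 1) x \<partial>lborel) =
      (\<integral>\<^sup>+x. g (x \<bullet> b) * indicator (cball 0 1) x \<partial>distr lborel borel f)"
    by (simp only: distr_lborel_orthogonal[OF f(1)])
  also have "\<dots> = (\<integral>\<^sup>+x. g (f x \<bullet> b) * indicator (cball 0 1) (f x) \<partial>lborel)"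
    by (subst nn_integral_distr) auto
  also have "\<dots> = (\<integral>\<^sup>+x. g (x \<bullet> e) * indicator (cball 0 1) x \<partial>lborel)"
    using f by (intro nn_integral_cong) (auto simp: indicator_def orthogonal_transformation_def orthogonal_transformation_norm simp flip: f(2))
  finally show ?thesis using nn_integral_unit_cball_axis[OF b(1) g] by simp
qed

lemma nn_integral_beta:
  assumes "(p :: real) > 0" "q > 0"
  shows "(\<integral>\<^sup>+s. ennreal (indicator {0..1} s * (s powr (p - 1) * (1 - s) powr (q - 1))) \<partial>lborel) = ennreal (Beta p q)"
  using nn_integral_has_integral_lebesgue[OF _ has_integral_Beta_real[OF assms]]
  by (simp add: mult.commute)

text \<open>The ratios \<open>Beta (p + k) q / Beta p q\<close> are the moments of the Beta distribution.\<close>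

lemma Beta_add_of_nat:
  assumes "(p :: real) > 0" "q > 0"
  shows "Beta (p + of_nat k) q = Beta p q * (pochhammer p k / pochhammer (p + q) k)"
proof (induction k)
  case (Suc k)
  have "p + of_nat k > 0" using assms by (intro add_pos_nonneg) simp_all
  then have "(p + of_nat k + q) * Beta (p + of_nat k + 1) q = (p + of_nat k) * Beta (p + of_nat k) q"
    by (intro Beta_plus1_left) (auto elim!: nonpos_Ints_cases)
  moreover have "p + of_nat k + q > 0" using assms by (intro add_pos_nonneg) simp_all
  ultimately have "Beta (p + of_nat (Suc k)) q = (p + of_nat k) / (p + q + of_nat k) * Beta (p + of_nat k) q"
    by (simp add: field_simps)
  also have "\<dots> = Beta p q * (pochhammer p (Suc k) / pochhammer (p + q) (Suc k))"
    unfolding Suc.IH by (simp add: pochhammer_Suc mult_ac)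
  finally show ?case .
qed simp

text \<open>The normalising constant \<open>C\<close> does not depend on \<open>k\<close>; it is the volume of the ball, which the case
  \<open>k = 0\<close> identifies without an evaluation of the Beta function.\<close>

lemma cball_beta_moments_up_to_constant:
  fixes e c :: "real ^ 'd"
  assumes e: "norm e = 1" and r: "r > 0"
  shows "\<exists>C\<ge>0. \<forall>k. (\<integral>\<^sup>+x. ennreal (((1 - ((x - c) \<bullet> e) / r) / 2) ^ k) * indicator (cball c r) x \<partial>lborel) =
    ennreal (C * beta_moment ((real CARD('d) + 1) / 2) k)"
proof -
  define m where "m = CARD('d) - 1"
  define a where "a = (real CARD('d) + 1) / 2"
  have am: "real m / 2 = a - 1" and a: "a > 0"
    by (simp_all add: a_def m_def of_nat_diff Suc_leI add_divide_distrib diff_divide_distrib)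
  define V where "V = unit_ball_vol (real m)"
  have V: "V > 0" by (simp add: V_def)
  define C where "C = r ^ CARD('d) * (2 ^ Suc m * V * Beta a a)"
  have Beta_nonneg: "Beta a a \<ge> 0"
    using a by (simp add: Beta_def Gamma_real_pos less_imp_le)
  have "(\<integral>\<^sup>+x. ennreal (((1 - ((x - c) \<bullet> e) / r) / 2) ^ k) * indicator (cball c r) x \<partial>lborel) =
      ennreal (C * beta_moment a k)" for k
  proof -
    let ?g = "\<lambda>t::real. ennreal (((1 - t) / 2) ^ k)"
    let ?h = "\<lambda>t::real. ?g t * ennreal (indicator {-1..1} t * (V * sqrt (1 - t\<^sup>2) ^ m))"
    have [measurable]: "cball c r \<in> sets borel" by simp
    have "(\<integral>\<^sup>+x. ?g (((x - c) \<bullet> e) / r) * indicator (cball c r) x \<partial>lborel) =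
        (\<integral>\<^sup>+x. ennreal (r ^ CARD('d)) * (?g (((c + r *\<^sub>R x - c) \<bullet> e) / r) * indicator (cball c r) (c + r *\<^sub>R x)) \<partial>lborel)"
      using r by (subst lborel_affine[of r c])
        (simp_all add: nn_integral_density nn_integral_distr)
    also have "\<dots> = ennreal (r ^ CARD('d)) * (\<integral>\<^sup>+x. ?g (x \<bullet> e) * indicator (cball 0 1) x \<partial>lborel)"
      using r by (subst nn_integral_cmult [symmetric])
        (auto intro!: nn_integral_cong simp: indicator_def dist_norm)
    also have "(\<integral>\<^sup>+x. ?g (x \<bullet> e) * indicator (cball 0 1) x \<partial>lborel) = (\<integral>\<^sup>+t. ?h t \<partial>lborel)"
      unfolding V_def m_def by (intro nn_integral_unit_cball_direction e) measurable
    \<comment> \<open>The substitution \<open>t = 1 - 2 s\<close> maps \<open>[0, 1]\<close> onto \<open>[-1, 1]\<close> and \<open>1 - t\<^sup>2\<close> becomes \<open>4 s (1 - s)\<close>.\<close>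
    also have "\<dots> = 2 * (\<integral>\<^sup>+s. ?h (1 + (-2) * s) \<partial>lborel)"
      by (subst nn_integral_real_affine[of _ "-2" 1]) (simp_all add: ennreal_numeral)
    also have "(\<integral>\<^sup>+s. ?h (1 + (-2) * s) \<partial>lborel) =
        (\<integral>\<^sup>+s. ennreal (2 ^ m * V) * ennreal (indicator {0..1} s * (s powr (a + real k - 1) * (1 - s) powr (a - 1))) \<partial>lborel)"
    proof (intro nn_integral_cong_AE, goal_cases)
      case 1
      have "AE s in lborel. s \<notin> {0, 1 :: real}"
        by (intro AE_not_in countable_imp_null_set_lborel) auto
      then show ?case
      proof eventually_elim
        case (elim s)
        show ?case
        proof (cases "s \<in> {0<..<1}")
          case True
          have "1 - (1 + (-2) * s)\<^sup>2 = 2\<^sup>2 * (s * (1 - s))" by (simp add: power2_eq_square algebra_simps)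
          then have "sqrt (1 - (1 + (-2) * s)\<^sup>2) = 2 * sqrt (s * (1 - s))"
            by (simp only: real_sqrt_mult) simp
          moreover have "sqrt (s * (1 - s)) ^ m = s powr (a - 1) * (1 - s) powr (a - 1)"
          proof -
            have "sqrt (s * (1 - s)) ^ m = ((s * (1 - s)) powr (1 / 2)) powr real m"
              using True by (simp add: powr_half_sqrt powr_realpow)
            also have "\<dots> = (s * (1 - s)) powr (a - 1)"
              by (simp add: powr_powr am)
            finally show ?thesis using True by (simp add: powr_mult)
          qed
          moreover have "s ^ k * s powr (a - 1) = s powr (a + real k - 1)"
            using True by (simp add: powr_realpow [symmetric] powr_add [symmetric] algebra_simps)
          ultimately show ?thesis
            using True V by (simp add: ennreal_mult' [symmetric] power_mult_distrib mult_ac)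
        qed (use elim in \<open>auto simp: indicator_def\<close>)
      qed
    qed
    also have "\<dots> = ennreal (2 ^ m * V) * ennreal (Beta (a + real k) a)"
      using a nn_integral_beta[of "a + real k" a] by (subst nn_integral_cmult) simp_all
    also have "Beta (a + real k) a = Beta a a * beta_moment a k"
      unfolding beta_moment_def mult_2 by (rule Beta_add_of_nat[OF a a])
    also have "ennreal (r ^ CARD('d)) * (2 * (ennreal (2 ^ m * V) * ennreal (Beta a a * beta_moment a k))) =
        ennreal (C * beta_moment a k)"
    proof -
      have "beta_moment a k \<ge> 0" using a by (simp add: beta_moment_def pochhammer_nonneg)
      then have M: "Beta a a * beta_moment a k \<ge> 0" using Beta_nonneg by simp
      have "ennreal u * (2 * (ennreal v * ennreal w)) = ennreal (u * (2 * v) * w)"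
        if "u \<ge> 0" "v \<ge> 0" "w \<ge> 0" for u v w :: real
        using that by (simp add: ennreal_mult mult_ac)
      from this[OF _ _ M, of "r ^ CARD('d)" "2 ^ m * V"] show ?thesis
        using r V by (simp add: C_def mult_ac)
    qed
    finally show ?thesis .
  qed
  moreover have "C \<ge> 0" using r V Beta_nonneg by (simp add: C_def)
  ultimately show ?thesis unfolding a_def by blast
qed

lemma has_bochner_integral_cball_moment:
  fixes e c :: "real ^ 'd"
  assumes e: "norm e = 1" and r: "r > 0"
  shows "has_bochner_integral lborel
    (\<lambda>x. indicator (cball c r) x * ((1 - ((x - c) \<bullet> e) / r) / 2) ^ k)
    (measure lborel (cball c r) * beta_moment ((real CARD('d) + 1) / 2) k)"
proof -
  define M where "M = beta_moment ((real CARD('d) + 1) / 2)"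
  obtain C where C: "C \<ge> 0" and moment:
    "\<And>k. (\<integral>\<^sup>+x. ennreal (((1 - ((x - c) \<bullet> e) / r) / 2) ^ k) * indicator (cball c r) x \<partial>lborel) = ennreal (C * M k)"
    using cball_beta_moments_up_to_constant[OF e r, of c] unfolding M_def by blast
  have "emeasure lborel (cball c r) = ennreal C"
    using moment[of 0] by (simp add: M_def beta_moment_def)
  then have vol: "measure lborel (cball c r) = C" using C by (simp add: measure_def)
  have nonneg: "0 \<le> indicator (cball c r) x * ((1 - ((x - c) \<bullet> e) / r) / 2) ^ k" for x
  proof (cases "x \<in> cball c r")
    case True
    have "(x - c) \<bullet> e \<le> norm (x - c) * norm e" by (rule norm_cauchy_schwarz)
    also have "\<dots> \<le> r" using True e by (simp add: dist_norm norm_minus_commute)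
    finally show ?thesis using r by simp
  qed simp
  have "(\<integral>\<^sup>+x. ennreal (indicator (cball c r) x * ((1 - ((x - c) \<bullet> e) / r) / 2) ^ k) \<partial>lborel) = ennreal (C * M k)"
    by (subst moment [symmetric]) (auto intro!: nn_integral_cong simp: indicator_def)
  moreover have "M k \<ge> 0" by (simp add: M_def beta_moment_def pochhammer_nonneg)
  moreover have "(\<lambda>x. indicator (cball c r) x * ((1 - ((x - c) \<bullet> e) / r) / 2) ^ k) \<in> borel_measurable borel"
  proof -
    have [measurable]: "cball c r \<in> sets borel" by simp
    show ?thesis by measurable
  qed
  ultimately show ?thesis
    unfolding vol M_def [symmetric] using C nonneg
    by (intro has_bochner_integral_nn_integral) auto
qed

section \<open>Polynomials of bounded total degree\<close>

lemma monomial_in_total_degree_space: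
  fixes \<alpha> :: "'d::finite \<Rightarrow> nat"
  assumes "(\<Sum>i\<in>UNIV. \<alpha> i) \<le> l"
  shows "(\<lambda>x. a * (\<Prod>i\<in>UNIV. x $ i ^ \<alpha> i)) \<in> total_degree_space l"
  unfolding total_degree_space_def
proof (intro CollectI exI ext)
  fix x :: "real ^ 'd"
  have "(\<Sum>\<beta> | (\<Sum>i\<in>UNIV. \<beta> i) \<le> l. (if \<beta> = \<alpha> then a else 0) * (\<Prod>i\<in>UNIV. x $ i ^ \<beta> i)) =
      (\<Sum>\<beta>\<in>{\<alpha>}. (if \<beta> = \<alpha> then a else 0) * (\<Prod>i\<in>UNIV. x $ i ^ \<beta> i))"
    using assms by (intro sum.mono_neutral_right finite_multi_indices) auto
  then show "a * (\<Prod>i\<in>UNIV. x $ i ^ \<alpha> i) =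
      (\<Sum>\<beta> | (\<Sum>i\<in>UNIV. \<beta> i) \<le> l. (if \<beta> = \<alpha> then a else 0) * (\<Prod>i\<in>UNIV. x $ i ^ \<beta> i))"
    by simp
qed

lemma total_degree_space_add:
  assumes "u \<in> total_degree_space l" "v \<in> total_degree_space l"
  shows "(\<lambda>x. u x + v x) \<in> total_degree_space l"
proof -
  obtain c d where "u = (\<lambda>x. \<Sum>\<alpha> | (\<Sum>i\<in>UNIV. \<alpha> i) \<le> l. c \<alpha> * (\<Prod>i\<in>UNIV. x $ i ^ \<alpha> i))"
    and "v = (\<lambda>x. \<Sum>\<alpha> | (\<Sum>i\<in>UNIV. \<alpha> i) \<le> l. d \<alpha> * (\<Prod>i\<in>UNIV. x $ i ^ \<alpha> i))"
    using assms by (auto simp: total_degree_space_def)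
  then show ?thesis unfolding total_degree_space_def
    by (intro CollectI exI[of _ "\<lambda>\<alpha>. c \<alpha> + d \<alpha>"]) (simp add: sum.distrib distrib_right)
qed

lemma total_degree_space_sum:
  assumes "finite I" "\<And>i. i \<in> I \<Longrightarrow> v i \<in> total_degree_space l"
  shows "(\<lambda>x. \<Sum>i\<in>I. v i x) \<in> total_degree_space l"
  using assms
proof (induction I rule: finite_induct)
  case empty
  show ?case unfolding total_degree_space_def by (intro CollectI exI[of _ "\<lambda>_. 0"]) simp
next
  case (insert i I)
  then show ?case by (simp add: total_degree_space_add)
qed

lemma total_degree_space_scale:
  assumes "v \<in> total_degree_space l"
  shows "(\<lambda>x. a * v x) \<in> total_degree_space l"
proof -
  obtain c where "v = (\<lambda>x. \<Sum>\<alpha> | (\<Sum>i\<in>UNIV. \<alpha> i) \<le> l. c \<alpha> * (\<Prod>i\<in>UNIV. x $ i ^ \<alpha> i))"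
    using assms by (auto simp: total_degree_space_def)
  then show ?thesis unfolding total_degree_space_def
    by (intro CollectI exI[of _ "\<lambda>\<alpha>. a * c \<alpha>"]) (simp add: sum_distrib_left mult.assoc)
qed

lemma total_degree_space_mono:
  assumes "l \<le> m"
  shows "total_degree_space l \<subseteq> total_degree_space m"
proof
  fix v :: "real ^ 'd \<Rightarrow> real" assume "v \<in> total_degree_space l"
  then obtain c where v: "v = (\<lambda>x. \<Sum>\<alpha> | (\<Sum>i\<in>UNIV. \<alpha> i) \<le> l. c \<alpha> * (\<Prod>i\<in>UNIV. x $ i ^ \<alpha> i))"
    by (auto simp: total_degree_space_def)
  show "v \<in> total_degree_space m"
    unfolding v using assms
    by (intro total_degree_space_sum finite_multi_indices monomial_in_total_degree_space) auto
qed

lemma total_degree_space_mult_coordinate: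
  fixes v :: "real ^ 'd \<Rightarrow> real"
  assumes "v \<in> total_degree_space l"
  shows "(\<lambda>x. x $ j * v x) \<in> total_degree_space (Suc l)"
proof -
  obtain c where v: "v = (\<lambda>x. \<Sum>\<alpha> | (\<Sum>i\<in>UNIV. \<alpha> i) \<le> l. c \<alpha> * (\<Prod>i\<in>UNIV. x $ i ^ \<alpha> i))"
    using assms by (auto simp: total_degree_space_def)
  define up where "up \<alpha> i = \<alpha> i + (if i = j then 1 else 0)" for \<alpha> :: "'d \<Rightarrow> nat" and i
  have "x $ j * (\<Prod>i\<in>UNIV. x $ i ^ \<alpha> i) = (\<Prod>i\<in>UNIV. x $ i ^ up \<alpha> i)" for x :: "real ^ 'd" and \<alpha>
  proof -
    have "(\<Prod>i\<in>UNIV. x $ i ^ up \<alpha> i) = (\<Prod>i\<in>UNIV. x $ i ^ \<alpha> i) * (\<Prod>i\<in>UNIV. if i = j then x $ i else 1)"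
      unfolding prod.distrib [symmetric] by (intro prod.cong) (auto simp: up_def)
    then show ?thesis by simp
  qed
  then have "(\<lambda>x. x $ j * v x) =
      (\<lambda>x. \<Sum>\<alpha> | (\<Sum>i\<in>UNIV. \<alpha> i) \<le> l. c \<alpha> * (\<Prod>i\<in>UNIV. x $ i ^ up \<alpha> i))"
    unfolding v by (simp add: sum_distrib_left mult.left_commute)
  also have "\<dots> \<in> total_degree_space (Suc l)"
    by (intro total_degree_space_sum finite_multi_indices monomial_in_total_degree_space)
      (simp add: up_def sum.distrib)
  finally show ?thesis .
qed

text \<open>Multiplication by an affine function \<open>b + x \<bullet> w\<close> is a combination of the identity and of
  multiplications by coordinates, so it raises the degree by at most one.\<close>

lemma affine_power_in_total_degree_space:
  fixes w :: "real ^ 'd"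
  shows "(\<lambda>x. (b + x \<bullet> w) ^ k) \<in> total_degree_space k"
proof (induction k)
  case 0
  show ?case using monomial_in_total_degree_space[of "\<lambda>_::'d. 0" 0 1] by simp
next
  case (Suc k)
  have "(\<lambda>x. (b + x \<bullet> w) ^ Suc k) =
     (\<lambda>x. b * (b + x \<bullet> w) ^ k + (\<Sum>i\<in>UNIV. w $ i * (x $ i * (b + x \<bullet> w) ^ k)))"
    by (simp add: inner_vec_def distrib_right sum_distrib_right mult_ac)
  also have "\<dots> \<in> total_degree_space (Suc k)"
  proof (intro total_degree_space_add total_degree_space_sum total_degree_space_scale
      total_degree_space_mult_coordinate Suc.IH finite)
    show "(\<lambda>x. (b + x \<bullet> w) ^ k) \<in> total_degree_space (Suc k)"
      using Suc.IH total_degree_space_mono[of k "Suc k"] by auto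
  qed
  finally show ?case .
qed

section \<open>The extremal ridge polynomial\<close>

text \<open>The Jacobi polynomial in the normalised distance \<open>s = (1 - (x - c) \<bullet> e / r) / 2\<close> of \<open>x\<close> from the
  tangent hyperplane of the ball at \<open>c + r *\<^sub>R e\<close>; it is constant on hyperplanes orthogonal to \<open>e\<close>.\<close>

definition ridge_polynomial :: "(real ^ 'd) \<Rightarrow> real \<Rightarrow> (real ^ 'd) \<Rightarrow> nat \<Rightarrow> real ^ 'd \<Rightarrow> real" where
  "ridge_polynomial c r e l x =
     (\<Sum>k\<le>l. jacobi_coeff ((real CARD('d) + 1) / 2) l k * ((1 - ((x - c) \<bullet> e) / r) / 2) ^ k)"

lemma continuous_on_ridge_polynomial: "continuous_on S (ridge_polynomial c r e l)"
  unfolding ridge_polynomial_def by (cases "r = 0") (auto intro!: continuous_intros)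

lemma ridge_polynomial_pole:
  fixes e :: "real ^ 'd"
  assumes "norm e = 1" "r > 0"
  shows "ridge_polynomial c r e l (c + r *\<^sub>R e) = 1"
proof -
  have "e \<bullet> e = 1" using assms(1) by (simp add: norm_eq_1)
  then have "ridge_polynomial c r e l (c + r *\<^sub>R e) =
     (\<Sum>k\<le>l. jacobi_coeff ((real CARD('d) + 1) / 2) l k * 0 ^ k)"
    using assms(2) by (simp add: ridge_polynomial_def)
  also have "\<dots> = (\<Sum>k\<in>{0}. jacobi_coeff ((real CARD('d) + 1) / 2) l k * 0 ^ k)"
    by (rule sum.mono_neutral_right) auto
  finally show ?thesis by (simp add: jacobi_coeff_def)
qed

lemma ridge_polynomial_in_total_degree_space:
  "ridge_polynomial c r e l \<in> total_degree_space l"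
proof -
  have "(1 - ((x - c) \<bullet> e) / r) / 2 = (1 + (c \<bullet> e) / r) / 2 + x \<bullet> ((- 1 / (2 * r)) *\<^sub>R e)" for x
    by (simp add: inner_diff_left diff_divide_distrib add_divide_distrib mult.commute)
  then have "ridge_polynomial c r e l =
    (\<lambda>x. \<Sum>k\<le>l. jacobi_coeff ((real CARD('a) + 1) / 2) l k *
        ((1 + (c \<bullet> e) / r) / 2 + x \<bullet> ((- 1 / (2 * r)) *\<^sub>R e)) ^ k)"
    by (intro ext) (simp only: ridge_polynomial_def)
  also have "\<dots> \<in> total_degree_space l"
  proof (intro total_degree_space_sum total_degree_space_scale)
    fix k assume "k \<in> {..l}"
    then show "(\<lambda>x. ((1 + (c \<bullet> e) / r) / 2 + x \<bullet> ((- 1 / (2 * r)) *\<^sub>R e)) ^ k) \<in> total_degree_space l"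
      by (intro subsetD[OF total_degree_space_mono, OF _ affine_power_in_total_degree_space]) simp
  qed simp
  finally show ?thesis .
qed

lemma has_bochner_integral_ridge_polynomial_square:
  fixes e c :: "real ^ 'd"
  assumes e: "norm e = 1" and r: "r > 0"
  defines "a \<equiv> (real CARD('d) + 1) / 2"
  shows "has_bochner_integral lborel (\<lambda>x. indicator (cball c r) x * (ridge_polynomial c r e l x)\<^sup>2)
    (measure lborel (cball c r) * (a / (a + real l) * (fact l / pochhammer (2 * a) l)))"
proof -
  let ?s = "\<lambda>x. (1 - ((x - c) \<bullet> e) / r) / 2"
  let ?c = "jacobi_coeff a l" and ?vol = "measure lborel (cball c r)"
  have "has_bochner_integral lborel
      (\<lambda>x. \<Sum>i\<le>l. \<Sum>k\<le>l. (?c i * ?c k) * (indicator (cball c r) x * ?s x ^ (k + i)))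
      (\<Sum>i\<le>l. \<Sum>k\<le>l. (?c i * ?c k) * (?vol * beta_moment a (k + i)))"
    unfolding a_def
    by (intro has_bochner_integral_sum has_bochner_integral_mult_right has_bochner_integral_cball_moment e r)
  moreover have "(\<lambda>x. \<Sum>i\<le>l. \<Sum>k\<le>l. (?c i * ?c k) * (indicator (cball c r) x * ?s x ^ (k + i))) =
      (\<lambda>x. indicator (cball c r) x * (ridge_polynomial c r e l x)\<^sup>2)"
    by (simp add: ridge_polynomial_def a_def power2_eq_square sum_product sum_distrib_left power_add mult_ac)
  moreover have "(\<Sum>i\<le>l. \<Sum>k\<le>l. (?c i * ?c k) * (?vol * beta_moment a (k + i))) =
      ?vol * (\<Sum>i\<le>l. \<Sum>k\<le>l. ?c i * ?c k * beta_moment a (k + i))"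
    by (simp add: sum_distrib_left mult_ac)
  moreover have "a > 0" by (simp add: a_def)
  ultimately show ?thesis by (simp only: jacobi_square_mean)
qed

section \<open>Testing the Christoffel constant at a contact point\<close>

text \<open>A point of the closure farthest from the centre: were its distance less than \<open>r\<close>, then a smaller
  concentric ball would contain \<open>D\<close>.\<close>

lemma chebyshev_ball_contact_point:
  fixes c :: "'a::euclidean_space"
  assumes D: "bounded D" "D \<noteq> {}" and sub: "D \<subseteq> cball c r"
    and least: "\<And>c' r'. D \<subseteq> cball c' r' \<Longrightarrow> r \<le> r'"
  obtains x where "x \<in> closure D" "dist c x = r"
proof -
  have "compact (closure D)" "closure D \<noteq> {}" using D by (auto simp: compact_closure)
  moreover have "continuous_on (closure D) (dist c)" by (intro continuous_intros)
  ultimately obtain x where x: "x \<in> closure D" "\<And>y. y \<in> closure D \<Longrightarrow> dist c y \<le> dist c x"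
    using continuous_attains_sup by meson
  have "D \<subseteq> cball c (dist c x)" using x(2) closure_subset[of D] by auto
  then have "r \<le> dist c x" by (rule least)
  moreover have "closure D \<subseteq> cball c r" using sub by (intro closure_minimal) simp_all
  ultimately show ?thesis using x(1) that by force
qed

lemma emeasure_lborel_open_pos:
  fixes S :: "'a::euclidean_space set"
  assumes "open S" "S \<noteq> {}"
  shows "emeasure lborel S > 0"
proof -
  have "\<not> negligible S" using assms by (rule open_not_negligible)
  then show ?thesis using assms(1)
    by (auto simp: negligible_iff_null_sets null_sets_completion_iff null_sets_def zero_less_iff_neq_zero)
qed

lemma L2_norm_sq_eq_lborel:
  assumes D: "open D" "emeasure lborel D \<noteq> 0" "emeasure lborel D < \<infinity>" and v: "continuous_on UNIV v"
  shows "L2_norm_sq D v = (\<integral>x. indicator D x * (v x)\<^sup>2 \<partial>lborel) / measure lborel D"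
proof -
  have Ds: "D \<in> sets lborel" using D(1) by simp
  have mv [measurable]: "v \<in> borel_measurable borel" by (rule borel_measurable_continuous_onI[OF v])
  have em: "emeasure lebesgue D = ennreal (measure lborel D)"
    using Ds D by (simp add: emeasure_eq_ennreal_measure less_top)
  have mpos: "measure lborel D > 0"
    using D by (simp add: measure_def enn2real_positive_iff zero_less_iff_neq_zero)
  have um: "uniform_measure lebesgue D = density lebesgue (\<lambda>x. ennreal (indicator D x / measure lborel D))"
    unfolding uniform_measure_def em using mpos
    by (intro arg_cong2[where f = density] refl ext) (auto simp: indicator_def divide_ennreal simp flip: ennreal_1)
  have Dl [measurable]: "D \<in> sets lebesgue" using Ds by simp
  have [measurable]: "v \<in> borel_measurable lebesgue" using mv by (simp add: measurable_completion)
  have "L2_norm_sq D v = (\<integral>x. (indicator D x / measure lborel D) *\<^sub>R (v x)\<^sup>2 \<partial>lebesgue)"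
    unfolding L2_norm_sq_def um using mpos by (subst integral_density) auto
  also have "\<dots> = (\<integral>x. (indicator D x / measure lborel D) *\<^sub>R (v x)\<^sup>2 \<partial>lborel)"
  proof (rule integral_completion)
    have [measurable]: "D \<in> sets borel" using Ds by simp
    show "(\<lambda>x. (indicator D x / measure lborel D) *\<^sub>R (v x)\<^sup>2) \<in> borel_measurable lborel"
      using mv by measurable
  qed
  also have "\<dots> = (\<integral>x. indicator D x * (v x)\<^sup>2 \<partial>lborel) / measure lborel D"
    by (simp add: mult.commute)
  finally show ?thesis .
qed

text \<open>A continuous function with vanishing \<open>L\<^sup>2\<close> norm is zero on the open set \<open>D\<close>, hence on its closure.
  Positivity guards the
  quotient by the norm against the convention that division by zero yields zero.\<close>

lemma L2_norm_sq_pos: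
  fixes v :: "real ^ 'd \<Rightarrow> real"
  assumes D: "open D" "bounded D" "D \<noteq> {}" and v: "continuous_on UNIV v"
    and x: "x \<in> closure D" "v x \<noteq> 0"
  shows "L2_norm_sq D v > 0"
proof -
  have fin: "emeasure lborel D < \<infinity>" using emeasure_bounded_finite[OF D(2)] by simp
  have pos: "0 < emeasure lborel D" using D(1,3) by (rule emeasure_lborel_open_pos)
  have "integrable lborel (\<lambda>y. indicator (closure D) y *\<^sub>R (v y)\<^sup>2)"
    using D(2) by (intro borel_integrable_compact continuous_intros continuous_on_subset[OF v])
      (simp_all add: compact_closure)
  then have "integrable lborel (\<lambda>y. indicator D y *\<^sub>R (indicator (closure D) y *\<^sub>R (v y)\<^sup>2))"
    using D(1) by (intro integrable_mult_indicator[of D lborel]) simp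
  also have "(\<lambda>y. indicator D y *\<^sub>R (indicator (closure D) y *\<^sub>R (v y)\<^sup>2)) = (\<lambda>y. indicator D y * (v y)\<^sup>2)"
    using closure_subset[of D] by (intro ext) (auto simp: indicator_def)
  finally have int: "integrable lborel (\<lambda>y. indicator D y * (v y)\<^sup>2)" .
  have "(\<integral>y. indicator D y * (v y)\<^sup>2 \<partial>lborel) \<noteq> 0"
  proof
    assume "(\<integral>y. indicator D y * (v y)\<^sup>2 \<partial>lborel) = 0"
    then have ae: "AE y in lborel. indicator D y * (v y)\<^sup>2 = 0"
      using integral_nonneg_eq_0_iff_AE[OF int] by simp
    define S where "S = D \<inter> {y. v y \<noteq> 0}"
    have "open S"
      unfolding S_def using D(1) v by (intro open_Int open_Collect_neq continuous_intros)
    have S: "{y \<in> space lborel. \<not> indicator D y * (v y)\<^sup>2 = 0} = S"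
      by (auto simp: S_def indicator_def)
    have "S \<in> null_sets lborel"
      using AE_iff_null[of lborel "\<lambda>y. indicator D y * (v y)\<^sup>2 = 0"] ae \<open>open S\<close> unfolding S by simp
    then have "S = {}" using emeasure_lborel_open_pos[OF \<open>open S\<close>] by (auto simp: null_sets_def)
    then have "D \<subseteq> {y. v y = 0}" by (auto simp: S_def)
    moreover have "closed {y. v y = 0}" using v by (intro closed_Collect_eq continuous_intros)
    ultimately have "closure D \<subseteq> {y. v y = 0}" by (rule closure_minimal)
    then show False using x by auto
  qed
  moreover have "(\<integral>y. indicator D y * (v y)\<^sup>2 \<partial>lborel) \<ge> 0"
    by (intro integral_nonneg_AE) simp
  ultimately have "(\<integral>y. indicator D y * (v y)\<^sup>2 \<partial>lborel) > 0" by linarith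
  moreover have "measure lborel D > 0"
    using pos fin by (simp add: measure_def enn2real_positive_iff)
  ultimately show ?thesis
    using L2_norm_sq_eq_lborel[OF D(1) _ fin v] pos by simp
qed

text \<open>The set where the quotient for \<open>v\<close> is at most \<open>K_const V D\<close> contains \<open>D\<close> and is closed.\<close>

lemma K_const_ge_at_closure_point:
  assumes v: "v \<in> V" "continuous_on UNIV v" and x: "x \<in> closure D" "v x \<noteq> 0"
  shows "ereal (\<bar>v x\<bar>\<^sup>2 / L2_norm_sq D v) \<le> K_const V D"
proof -
  let ?S = "{y. ereal (\<bar>v y\<bar>\<^sup>2 / L2_norm_sq D v) \<le> K_const V D}"
  have "D \<subseteq> ?S"
  proof
    fix y assume y: "y \<in> D"
    have "v \<noteq> (\<lambda>_. 0)" using x(2) by auto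
    then have "ereal (\<bar>v y\<bar>\<^sup>2 / L2_norm_sq D v) \<le> k_fun V D y"
      unfolding k_fun_def using v(1) by (intro SUP_upper) simp
    also have "\<dots> \<le> K_const V D" unfolding K_const_def using y by (rule SUP_upper)
    finally show "y \<in> ?S" by simp
  qed
  moreover have "closed ?S"
    unfolding divide_inverse
    by (intro closed_Collect_le continuous_on_ereal continuous_intros v(2))
  ultimately have "closure D \<subseteq> ?S" by (rule closure_minimal)
  then show ?thesis using x(1) by auto
qed

theorem theorem5p6:
  fixes D B :: "(real ^ 'd) set" and n l :: nat
  assumes "open D" and "bounded D" and "D \<noteq> {}"
    and "is_chebyshev_ball D B"
    and "n = (CARD('d) + l) choose l"
  shows "K_const (total_degree_space l) D \<ge>
    ereal (exp (-1) * (measure lebesgue D / measure lebesgue B)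
      * real n powr ((real CARD('d) + 1) / real CARD('d)))"
proof -
  obtain c r where B: "B = cball c r" "D \<subseteq> cball c r" "\<And>c' r'. D \<subseteq> cball c' r' \<Longrightarrow> r \<le> r'"
    using assms(4) unfolding is_chebyshev_ball_def by (elim exE conjE) auto
  obtain x where x: "x \<in> closure D" "dist c x = r"
    using chebyshev_ball_contact_point[OF assms(2,3) B(2)] B(3) by metis
  have D_pos: "0 < emeasure lborel D" using assms(1,3) by (rule emeasure_lborel_open_pos)
  have D_fin: "emeasure lborel D < \<infinity>"
    using emeasure_bounded_finite[OF assms(2)] by simp
  have vol_D: "measure lborel D > 0"
    using D_pos D_fin by (simp add: measure_def enn2real_positive_iff)
  have r: "r > 0"
  proof -
    have "emeasure lborel D \<le> emeasure lborel (cball c r)" using B(2) by (intro emeasure_mono) auto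
    then have "measure lborel (cball c r) > 0"
      using D_pos emeasure_bounded_finite[OF bounded_cball, of c r]
      by (auto simp: measure_def enn2real_positive_iff)
    then show ?thesis by simp
  qed
  then have vol_B: "measure lborel (cball c r) > 0" by simp
  define e where "e = (1 / r) *\<^sub>R (x - c)"
  have e: "norm e = 1" "x = c + r *\<^sub>R e"
    using x(2) r by (auto simp: e_def dist_norm norm_minus_commute)
  define v where "v = ridge_polynomial c r e l"
  have v: "v \<in> total_degree_space l" "continuous_on UNIV v" "v x = 1"
    unfolding v_def e(2)
    by (auto intro: ridge_polynomial_in_total_degree_space continuous_on_ridge_polynomial
        ridge_polynomial_pole e(1) r)
  define Q where "Q = (real CARD('d) + 1) / 2 / ((real CARD('d) + 1) / 2 + real l) *
    (fact l / pochhammer (2 * ((real CARD('d) + 1) / 2)) l)"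
  have ball_mean: "has_bochner_integral lborel (\<lambda>x. indicator (cball c r) x * (v x)\<^sup>2) (measure lborel (cball c r) * Q)"
    unfolding v_def Q_def by (rule has_bochner_integral_ridge_polynomial_square[OF e(1) r])
  have N_pos: "L2_norm_sq D v > 0"
    using L2_norm_sq_pos[OF assms(1-3) v(2) x(1)] v(3) by simp
  have "L2_norm_sq D v * measure lborel D \<le> measure lborel (cball c r) * Q"
  proof -
    have "L2_norm_sq D v * measure lborel D = (\<integral>x. indicator D x * (v x)\<^sup>2 \<partial>lborel)"
      using L2_norm_sq_eq_lborel[OF assms(1) _ D_fin v(2)] D_pos vol_D by simp
    also have "\<dots> \<le> (\<integral>x. indicator (cball c r) x * (v x)\<^sup>2 \<partial>lborel)"
      using B(2) ball_mean
      by (intro integral_mono') (auto simp: has_bochner_integral_iff indicator_def)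
    also have "\<dots> = measure lborel (cball c r) * Q"
      using ball_mean by (rule has_bochner_integral_integral_eq)
    finally show ?thesis .
  qed
  then have N_le: "L2_norm_sq D v \<le> measure lborel (cball c r) / measure lborel D * Q"
    using vol_D by (simp add: field_simps)
  let ?E = "exp (-1) * real n powr ((real CARD('d) + 1) / real CARD('d))"
  let ?T = "exp (-1) * (measure lborel D / measure lborel (cball c r)) * real n powr ((real CARD('d) + 1) / real CARD('d))"
  have "?T * L2_norm_sq D v \<le> ?T * (measure lborel (cball c r) / measure lborel D * Q)"
    by (intro mult_left_mono N_le) simp
  also have "\<dots> = ?E * Q" using vol_D vol_B by simp
  also have "\<dots> \<le> 1"
    unfolding Q_def assms(5) by (rule christoffel_lower_bound) simp
  finally have "?T \<le> 1 / L2_norm_sq D v" using N_pos by (simp add: field_simps)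
  then have "ereal ?T \<le> ereal (\<bar>v x\<bar>\<^sup>2 / L2_norm_sq D v)" using v(3) by simp
  also have "\<dots> \<le> K_const (total_degree_space l) D"
    using v x(1) by (intro K_const_ge_at_closure_point) auto
  finally show ?thesis
    using assms(1) by (simp add: B(1) measure_completion borel_open)
qed

end
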